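(* Let $D\subset\mathbb{R}^2$ be an open set with coordinates $(t,x)$, let $\kappa\neq 0$ be a constant, and let $\sigma,v,\alpha$ be smooth functions on $D$ with $\sigma$ nowhere zero. Suppose that $b_+,b_1$ are smooth functions on $D$ satisfying the closed system of two nonlinear PDEs $$\partial_t\Big(\frac{\kappa b_+ + v}{\sigma}\Big) + \partial_x\Big(\partial_x b_+ - \frac{b_+(\kappa b_+ + v)}{\sigma} - 2b_1\Big) = 0,$$ $$\partial_t\Big(\frac{\kappa b_1-\alpha}{\sigma}\Big)+\partial_{xx}b_1-b_+\,\partial_x\Big(\frac{\kappa b_1-\alpha}{\sigma}\Big)+\Big(\frac{\kappa b_++v}{\sigma}\Big)\partial_x b_1=2\Big(\frac{\kappa b_1-\alpha}{\sigma}\Big)\partial_x b_+ ,$$ where the second equation may equivalently be replaced by $$\kappa\,\partial_t b_1 + \sigma\,\partial_{xx}b_1 + v\,\partial_x b_1 = \Big(2\partial_x b_+ + \frac{\partial_t\sigma}{\sigma} - \frac{\partial_x\sigma}{\sigma}b_+\Big)(\kappa b_1-\alpha) + \partial_t\alpha - b_+\,\partial_x\alpha .$$ Choose arbitrarily a nowhere vanishing smooth function $L_+$ on $D$, and smooth functions $L_1,B_1$ on $D$ related by $b_+L_1-B_1=b_1$ (so $L_1$ may be chosen arbitrarily and then determines $B_1$; or, where $b_+\neq0$, $B_1$ may be chosen arbitrarily and then determines $L_1$). Define the remaining entries of the matrices $$L=\begin{pmatrix} L_1&L_+\\ L_-&L_2\end{pmatrix},\qquad B=\begin{pmatrix} B_1&B_+\\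 B_-&B_2\end{pmatrix}$$ by $$B_+=b_+L_+,\qquad L_1+L_2=-\frac{\kappa b_++v}{\sigma}-\frac{\partial_xL_+}{L_+},\qquad B_1+B_2=\partial_xb_+-\frac{b_+(\kappa b_++v)}{\sigma}-2b_1-\frac{\partial_tL_+}{L_+},$$ $$L_-=\frac1{L_+}\Big(\frac{\kappa b_1-\alpha-(\kappa b_++v)L_1}{\sigma}-L_1^2-\partial_xL_1\Big),\qquad B_-=b_+L_-+\frac{\partial_xB_1-\partial_tL_1}{L_+}.$$ Then $(L,B)$ is a Lax pair, i.e. $\partial_tL-\partial_xB+LB-BL=0$ on $D$, and for every (smooth, possibly only locally defined) solution $(\mathcal F,G)^T$ of the linear system $$\partial_x\begin{pmatrix}\mathcal F\\ G\end{pmatrix}=L\begin{pmatrix}\mathcal F\\ G\end{pmatrix},\qquad \partial_t\begin{pmatrix}\mathcal F\\ G\end{pmatrix}=B\begin{pmatrix}\mathcal F\\ G\end{pmatrix},$$ the first component satisfies the Fokker–Planck equation $$\big(\kappa\,\partial_t+\sigma(t,x)\,\partial_{xx}+v(t,x)\,\partial_x+\alpha(t,x)\big)\mathcal F(t,x)=0 .$$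
   Context: All functions are real-valued (or complex-valued) functions of the two real variables $(t,x)$. A Lax pair here means a pair of $2\times2$ matrix functions $(L,B)$ of $(t,x)$ satisfying the zero curvature equation $\partial_tL-\partial_xB+LB-BL=0$, which is the compatibility condition of the linear system $\partial_x\Psi=L\Psi$, $\partial_t\Psi=B\Psi$; an eigenvector of the pair is a vector solution $\Psi$ of this system. *)

theory Defs
  imports "HOL-Analysis.Analysis"
begin

text \<open>Points of the plane are pairs \<open>(t, x)\<close>. The codomain is a general normed space, so
  that the same operators apply to scalar, vector and matrix functions.\<close>

definition pd_t :: "(real \<times> real \<Rightarrow> 'b::real_normed_vector) \<Rightarrow> real \<times> real \<Rightarrow> 'b" where
  "pd_t f p = vector_derivative (\<lambda>s. f (s, snd p)) (at (fst p))"

definition pd_x :: "(real \<times> real \<Rightarrow> 'b::real_normed_vector) \<Rightarrow> real \<times> real \<Rightarrow> 'b" where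
  "pd_x f p = vector_derivative (\<lambda>y. f (fst p, y)) (at (snd p))"

text \<open>Meant for open \<open>S\<close> only: the derivatives are full ones, not relative to \<open>S\<close>.\<close>

primrec Ck_on :: "nat \<Rightarrow> 'a::real_normed_vector set \<Rightarrow> ('a \<Rightarrow> 'b::real_normed_vector) \<Rightarrow> bool" where
  "Ck_on 0 S f \<longleftrightarrow> continuous_on S f"
| "Ck_on (Suc k) S f \<longleftrightarrow>
     (\<forall>p\<in>S. f differentiable (at p)) \<and>
     (\<forall>h. Ck_on k S (\<lambda>p. frechet_derivative f (at p) h))"

definition smooth_on :: "'a::real_normed_vector set \<Rightarrow> ('a \<Rightarrow> 'b::real_normed_vector) \<Rightarrow> bool" where
  "smooth_on S f \<longleftrightarrow> (\<forall>k. Ck_on k S f)"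

definition mat2 :: "'a::zero \<Rightarrow> 'a \<Rightarrow> 'a \<Rightarrow> 'a \<Rightarrow> 'a^2^2" where
  "mat2 a b c d = vector [vector [a, b], vector [c, d]]"

text \<open>Differentiability is required because \<^const>\<open>vector_derivative\<close> is total: without it
  the zero curvature equation could hold by accident.\<close>

definition lax_pair_on ::
  "(real \<times> real) set \<Rightarrow> (real \<times> real \<Rightarrow> 'a::real_normed_field^2^2) \<Rightarrow>
     (real \<times> real \<Rightarrow> 'a^2^2) \<Rightarrow> bool" where
  "lax_pair_on D L B \<longleftrightarrow>
     L differentiable_on D \<and> B differentiable_on D \<and>
     (\<forall>p\<in>D. pd_t L p - pd_x B p + L p ** B p - B p ** L p = 0)"

definition lax_eigenvector_on ::
  "(real \<times> real) set \<Rightarrow> (real \<times> real \<Rightarrow> 'a::real_normed_field^2^2) \<Rightarrow>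
     (real \<times> real \<Rightarrow> 'a^2^2) \<Rightarrow> (real \<times> real \<Rightarrow> 'a^2) \<Rightarrow> bool" where
  "lax_eigenvector_on U L B \<Psi> \<longleftrightarrow>
     smooth_on U \<Psi> \<and> (\<forall>p\<in>U. pd_x \<Psi> p = L p *v \<Psi> p \<and> pd_t \<Psi> p = B p *v \<Psi> p)"

definition first_pde_on ::
  "(real \<times> real) set \<Rightarrow> 'a::real_normed_field \<Rightarrow> (real \<times> real \<Rightarrow> 'a) \<Rightarrow> (real \<times> real \<Rightarrow> 'a) \<Rightarrow>
     (real \<times> real \<Rightarrow> 'a) \<Rightarrow> (real \<times> real \<Rightarrow> 'a) \<Rightarrow> bool" where
  "first_pde_on D \<kappa> \<sigma> v bp b1 \<longleftrightarrow>
     (\<forall>p\<in>D. pd_t (\<lambda>q. (\<kappa> * bp q + v q) / \<sigma> q) p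
        + pd_x (\<lambda>q. pd_x bp q - bp q * (\<kappa> * bp q + v q) / \<sigma> q - 2 * b1 q) p = 0)"

definition second_pde_on ::
  "(real \<times> real) set \<Rightarrow> 'a::real_normed_field \<Rightarrow> (real \<times> real \<Rightarrow> 'a) \<Rightarrow> (real \<times> real \<Rightarrow> 'a) \<Rightarrow>
     (real \<times> real \<Rightarrow> 'a) \<Rightarrow> (real \<times> real \<Rightarrow> 'a) \<Rightarrow> (real \<times> real \<Rightarrow> 'a) \<Rightarrow> bool" where
  "second_pde_on D \<kappa> \<sigma> v \<alpha> bp b1 \<longleftrightarrow>
     (\<forall>p\<in>D. pd_t (\<lambda>q. (\<kappa> * b1 q - \<alpha> q) / \<sigma> q) p + pd_x (pd_x b1) p
        - bp p * pd_x (\<lambda>q. (\<kappa> * b1 q - \<alpha> q) / \<sigma> q) p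
        + (\<kappa> * bp p + v p) / \<sigma> p * pd_x b1 p
        = 2 * ((\<kappa> * b1 p - \<alpha> p) / \<sigma> p) * pd_x bp p)"

definition second_pde_alt_on ::
  "(real \<times> real) set \<Rightarrow> 'a::real_normed_field \<Rightarrow> (real \<times> real \<Rightarrow> 'a) \<Rightarrow> (real \<times> real \<Rightarrow> 'a) \<Rightarrow>
     (real \<times> real \<Rightarrow> 'a) \<Rightarrow> (real \<times> real \<Rightarrow> 'a) \<Rightarrow> (real \<times> real \<Rightarrow> 'a) \<Rightarrow> bool" where
  "second_pde_alt_on D \<kappa> \<sigma> v \<alpha> bp b1 \<longleftrightarrow>
     (\<forall>p\<in>D. \<kappa> * pd_t b1 p + \<sigma> p * pd_x (pd_x b1) p + v p * pd_x b1 p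
        = (2 * pd_x bp p + pd_t \<sigma> p / \<sigma> p - pd_x \<sigma> p / \<sigma> p * bp p) * (\<kappa> * b1 p - \<alpha> p)
          + pd_t \<alpha> p - bp p * pd_x \<alpha> p)"

end

(* Once L2, L_-, B_+, B_- and B2 are eliminated, the (1,1) and (1,2) entries of the zero curvature
   equation hold identically. Its trace is the first PDE, up to the symmetry of the mixed partial
   derivatives of ln L_+; the (2,1) entry is a combination of both PDEs, again by the symmetry of
   mixed partials, now of L1. The Fokker-Planck equation comes from eliminating G between
   F_x = L1 F + L_+ G, its x-derivative, and F_t = - b1 F + b_+ F_x. *)
theory Submission
  imports Defs
begin

text \<open>The prescriptions come from a scalar system. Put w = (\<kappa> b_+ + v)/\<sigma> and q =
  (\<kappa> b1 - \<alpha>)/\<sigma>. Inserting F_t = b_+ F_x - b1 F turns the Fokker-Planck equation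
  into F_xx = - w F_x + q F, and equating F_xxt with F_txx, separately for the coefficients of F_x
  and of F, gives exactly the two PDEs. The matrices are this system in the frame (F, G) with G
  defined by F_x = L1 F + L_+ G, whence the freedom in L1 and L_+. The trace of L and L_- encode the
  equation for F_xx; B_- and the trace of B are the (1,1) and (1,2) entries of the zero curvature
  equation solved for them. Two obstacles shape the formal argument. Values lie in an arbitrary real
  normed field, which may be incomplete and need not carry a logarithm, so the symmetry of second
  derivatives is proved by a mean value estimate and ln L_+ enters only through quotients. The
  remaining entries are prescribed on D alone, with no regularity assumed, so each is replaced by
  its formula on the open set before it is differentiated.\<close>

section \<open>Symmetry of mixed second derivatives\<close>

text \<open>The limit is the derivative along \<open>u\<close> of the derivative of \<open>f\<close> along \<open>v\<close>, whereas the
  second difference is symmetric in \<open>u\<close> and \<open>v\<close>: this gives Young's theorem, in normed spaces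
  that need not be complete.\<close>

lemma second_difference_tendsto:
  fixes f :: "'a::real_normed_vector \<Rightarrow> 'b::real_normed_vector"
  assumes S: "open S" "p \<in> S"
    and f: "\<And>q. q \<in> S \<Longrightarrow> f differentiable (at q)"
    and A: "((\<lambda>q. frechet_derivative f (at q) v) has_derivative A) (at p)"
  shows "((\<lambda>h. (f (p + h *\<^sub>R u + h *\<^sub>R v) - f (p + h *\<^sub>R u) - f (p + h *\<^sub>R v) + f p) /\<^sub>R h\<^sup>2)
    \<longlongrightarrow> A u) (at_right 0)"
proof -
  define g where "g q = frechet_derivative f (at q) v" for q
  \<comment> \<open>The summand 1 keeps \<open>M\<close> positive when \<open>u\<close> and
    \<open>v\<close> both vanish, so that it can be divided by.\<close>
  define M where "M = norm u + norm v + 1"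
  have M: "M > 0" "norm u \<le> M" "norm v \<le> M" by (auto simp: M_def add_nonneg_pos)
  have lin: "linear A" using A by (rule has_derivative_linear)
  have derl: "((\<lambda>s. f (a + s *\<^sub>R v)) has_vector_derivative g (a + s *\<^sub>R v)) (at s)"
    if "a + s *\<^sub>R v \<in> S" for a s
  proof -
    let ?f' = "frechet_derivative f (at (a + s *\<^sub>R v))"
    have 1: "(f has_derivative ?f') (at (a + s *\<^sub>R v))"
      using f[OF that] by (simp add: frechet_derivative_works)
    have "((\<lambda>s. a + s *\<^sub>R v) has_derivative (\<lambda>h. h *\<^sub>R v)) (at s)"
      by (auto intro!: derivative_eq_intros)
    from has_derivative_compose[OF this 1]
    show ?thesis
      using has_derivative_linear[OF 1]
      by (simp add: has_vector_derivative_def g_def linear_cmul)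
  qed
  show ?thesis
  proof (rule tendstoI)
    fix e :: real assume e: "e > 0"
    \<comment> \<open>Two remainders of size \<open>\<epsilon> * (2 * (h * M))\<close>, integrated
      over a length \<open>h\<close>, make \<open>4 * M * \<epsilon> * h\<^sup>2\<close>, which is
      half of \<open>e * h\<^sup>2\<close>.\<close>
    define \<epsilon> where "\<epsilon> = e / (8 * M)"
    have \<epsilon>: "\<epsilon> > 0" using e M by (simp add: \<epsilon>_def)
    obtain d1 where d1: "d1 > 0"
      "\<And>q. norm (q - p) < d1 \<Longrightarrow> norm (g q - g p - A (q - p)) \<le> \<epsilon> * norm (q - p)"
      using A \<epsilon> unfolding has_derivative_at_alt g_def by blast
    obtain d2 where d2: "d2 > 0" "ball p d2 \<subseteq> S"
      using S open_contains_ball by blast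
    define d where "d = min d1 d2 / (2 * M)"
    have d: "d > 0" using d1 d2 M by (simp add: d_def)
    have "dist ((f (p + h *\<^sub>R u + h *\<^sub>R v) - f (p + h *\<^sub>R u) - f (p + h *\<^sub>R v) + f p) /\<^sub>R h\<^sup>2) (A u) < e"
      if h: "0 < h" "h < d" for h
    proof -
      have small: "norm (a *\<^sub>R u + s *\<^sub>R v) \<le> 2 * (h * M)" if "\<bar>a\<bar> \<le> h" "\<bar>s\<bar> \<le> h" for a s
      proof -
        have "norm (a *\<^sub>R u + s *\<^sub>R v) \<le> \<bar>a\<bar> * norm u + \<bar>s\<bar> * norm v"
          using norm_triangle_ineq[of "a *\<^sub>R u" "s *\<^sub>R v"] by simp
        also have "\<dots> \<le> h * M + h * M"
          using that M h by (intro add_mono mult_mono) auto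
        finally show ?thesis by (simp add: mult.commute)
      qed
      have hM: "2 * (h * M) < d1" "2 * (h * M) < d2"
        using h M unfolding d_def by (auto simp: field_simps)
      have inS: "p + a *\<^sub>R u + s *\<^sub>R v \<in> S" if "\<bar>a\<bar> \<le> h" "\<bar>s\<bar> \<le> h" for a s
      proof -
        have "norm (a *\<^sub>R u + s *\<^sub>R v) < d2" using small[OF that] hM by simp
        then have "p + (a *\<^sub>R u + s *\<^sub>R v) \<in> ball p d2"
          by (subst mem_ball, subst dist_commute) (simp add: dist_norm)
        then show ?thesis using d2 by (auto simp: add.assoc)
      qed
      have R: "norm (g (p + a *\<^sub>R u + s *\<^sub>R v) - g p - A (a *\<^sub>R u + s *\<^sub>R v)) \<le> \<epsilon> * (2 * (h * M))"
        if "\<bar>a\<bar> \<le> h" "\<bar>s\<bar> \<le> h" for a s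
      proof -
        have "norm (g (p + a *\<^sub>R u + s *\<^sub>R v) - g p - A (a *\<^sub>R u + s *\<^sub>R v)) \<le> \<epsilon> * norm (a *\<^sub>R u + s *\<^sub>R v)"
          using d1(2)[of "p + a *\<^sub>R u + s *\<^sub>R v"] small[OF that] hM by (simp add: add.assoc)
        also have "\<dots> \<le> \<epsilon> * (2 * (h * M))"
          using small[OF that] \<epsilon> by (intro mult_left_mono) auto
        finally show ?thesis .
      qed
      \<comment> \<open>The increment of \<open>\<phi>\<close> over \<open>[0, h]\<close> is the
        second difference minus \<open>h\<^sup>2 *\<^sub>R A u\<close>. Its velocity involves only
        derivatives along \<open>v\<close>, so the mean value inequality reduces the claim to
        first-order information on \<open>g\<close>.\<close>
      define \<phi> where "\<phi> s = f (p + h *\<^sub>R u + s *\<^sub>R v) - f (p + s *\<^sub>R v) - s *\<^sub>R (h *\<^sub>R A u)" for s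
      define \<phi>' where "\<phi>' s = g (p + h *\<^sub>R u + s *\<^sub>R v) - g (p + s *\<^sub>R v) - h *\<^sub>R A u" for s
      have der: "(\<phi> has_vector_derivative \<phi>' s) (at s)" if "0 \<le> s" "s \<le> h" for s
        unfolding \<phi>_def \<phi>'_def
        using inS[of h s] inS[of 0 s] that h
        by (auto intro!: derivative_eq_intros derl)
      have bnd: "norm (\<phi>' s) \<le> \<epsilon> * (4 * (h * M))" if "0 \<le> s" "s \<le> h" for s
      proof -
        \<comment> \<open>Both remainders are taken at the common base point \<open>p\<close>; by
          linearity of \<open>A\<close> the contributions of \<open>s *\<^sub>R v\<close> cancel and
          only \<open>h *\<^sub>R A u\<close> survives.\<close>
        have eq: "\<phi>' s = (g (p + h *\<^sub>R u + s *\<^sub>R v) - g p - A (h *\<^sub>R u + s *\<^sub>R v))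
            - (g (p + 0 *\<^sub>R u + s *\<^sub>R v) - g p - A (0 *\<^sub>R u + s *\<^sub>R v))"
          by (simp add: \<phi>'_def linear_add[OF lin] linear_cmul[OF lin])
        have "norm (\<phi>' s) \<le> \<epsilon> * (2 * (h * M)) + \<epsilon> * (2 * (h * M))"
          unfolding eq by (rule order_trans[OF norm_triangle_ineq4 add_mono]; rule R)
            (use that h in auto)
        then show ?thesis by (simp add: mult_ac)
      qed
      have "norm (\<phi> h - \<phi> 0) \<le> h * (\<epsilon> * (4 * (h * M))) - 0 * (\<epsilon> * (4 * (h * M)))"
      proof (rule differentiable_bound_general[OF h(1)])
        show "continuous_on {0..h} \<phi>"
          using der by (intro continuous_at_imp_continuous_on ballI)
            (auto intro: has_vector_derivative_continuous)
        show "\<And>s. 0 < s \<Longrightarrow> s < h \<Longrightarrow>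
            ((\<lambda>s. s * (\<epsilon> * (4 * (h * M)))) has_vector_derivative (\<epsilon> * (4 * (h * M)))) (at s)"
          by (auto intro!: derivative_eq_intros)
      qed (auto intro!: der bnd continuous_intros)
      moreover have "\<phi> h - \<phi> 0 =
          (f (p + h *\<^sub>R u + h *\<^sub>R v) - f (p + h *\<^sub>R u) - f (p + h *\<^sub>R v) + f p) - h\<^sup>2 *\<^sub>R A u"
        by (simp add: \<phi>_def power2_eq_square)
      moreover have "h * (\<epsilon> * (4 * (h * M))) = h\<^sup>2 * (e / 2)"
        using M by (simp add: \<epsilon>_def power2_eq_square)
      ultimately have *: "norm ((f (p + h *\<^sub>R u + h *\<^sub>R v) - f (p + h *\<^sub>R u) - f (p + h *\<^sub>R v) + f p)
           - h\<^sup>2 *\<^sub>R A u) \<le> h\<^sup>2 * (e / 2)" (is "norm (?\<Delta> - _) \<le> _")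
        by simp
      have "?\<Delta> /\<^sub>R h\<^sup>2 - A u = (?\<Delta> - h\<^sup>2 *\<^sub>R A u) /\<^sub>R h\<^sup>2"
        using h by (simp add: scaleR_diff_right)
      then have "norm (?\<Delta> /\<^sub>R h\<^sup>2 - A u) = norm (?\<Delta> - h\<^sup>2 *\<^sub>R A u) / h\<^sup>2"
        using h by (simp add: divide_inverse mult.commute)
      also have "\<dots> \<le> e / 2"
        using * h by (simp add: field_simps)
      finally show ?thesis using e by (simp add: dist_norm)
    qed
    then show "\<forall>\<^sub>F h in at_right 0. dist ((f (p + h *\<^sub>R u + h *\<^sub>R v) - f (p + h *\<^sub>R u)
        - f (p + h *\<^sub>R v) + f p) /\<^sub>R h\<^sup>2) (A u) < e"
      unfolding eventually_at_right_field using d by (intro exI[of _ d]) auto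
  qed
qed

lemma frechet_derivative_commute:
  fixes f :: "'a::real_normed_vector \<Rightarrow> 'b::real_normed_vector"
  assumes S: "open S" "p \<in> S"
    and f: "\<And>q. q \<in> S \<Longrightarrow> f differentiable (at q)"
    and "(\<lambda>q. frechet_derivative f (at q) u) differentiable (at p)"
    and "(\<lambda>q. frechet_derivative f (at q) v) differentiable (at p)"
  shows "frechet_derivative (\<lambda>q. frechet_derivative f (at q) u) (at p) v
    = frechet_derivative (\<lambda>q. frechet_derivative f (at q) v) (at p) u"
proof -
  have "((\<lambda>h. (f (p + h *\<^sub>R u + h *\<^sub>R v) - f (p + h *\<^sub>R u) - f (p + h *\<^sub>R v) + f p) /\<^sub>R h\<^sup>2)
    \<longlongrightarrow> frechet_derivative (\<lambda>q. frechet_derivative f (at q) v) (at p) u) (at_right 0)"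
    by (rule second_difference_tendsto[OF S f])
      (use assms(5) in \<open>simp_all flip: frechet_derivative_works\<close>)
  moreover have "((\<lambda>h. (f (p + h *\<^sub>R v + h *\<^sub>R u) - f (p + h *\<^sub>R v) - f (p + h *\<^sub>R u) + f p) /\<^sub>R h\<^sup>2)
    \<longlongrightarrow> frechet_derivative (\<lambda>q. frechet_derivative f (at q) u) (at p) v) (at_right 0)"
    by (rule second_difference_tendsto[OF S f])
      (use assms(4) in \<open>simp_all flip: frechet_derivative_works\<close>)
  then have "((\<lambda>h. (f (p + h *\<^sub>R u + h *\<^sub>R v) - f (p + h *\<^sub>R u) - f (p + h *\<^sub>R v) + f p) /\<^sub>R h\<^sup>2)
    \<longlongrightarrow> frechet_derivative (\<lambda>q. frechet_derivative f (at q) u) (at p) v) (at_right 0)"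
    by (simp add: algebra_simps)
  ultimately show ?thesis
    by (intro tendsto_unique[of "at_right (0::real)"]) simp_all
qed

section \<open>Locality of derivatives and of the classes C^k\<close>

lemma frechet_derivative_cong_open:
  assumes "open S" "p \<in> S" "\<And>q. q \<in> S \<Longrightarrow> f q = g q"
  shows "frechet_derivative f (at p) = frechet_derivative g (at p)"
proof -
  \<comment> \<open>The two functions have the same candidate derivatives, so the choice operator
    returns the same value, even at points where no derivative exists.\<close>
  have "(f has_derivative f') (at p) \<longleftrightarrow> (g has_derivative f') (at p)" for f'
    using assms by (metis has_derivative_transform_within_open)
  then show ?thesis by (simp add: frechet_derivative_def)
qed

lemma differentiable_cong_open:
  assumes "open S" "p \<in> S" "\<And>q. q \<in> S \<Longrightarrow> f q = g q"
  shows "f differentiable (at p) \<longleftrightarrow> g differentiable (at p)"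
  using assms has_derivative_transform_within_open[of f _ p UNIV S g]
    has_derivative_transform_within_open[of g _ p UNIV S f]
  unfolding differentiable_def by auto

text \<open>On an open set, agreement of functions passes to their full derivatives on the same set,
  which closes the induction. This is how smoothness reaches \<open>pd_t f\<close> and
  \<open>pd_x f\<close>, which are identified with values of the Frechet derivative only on the
  domain.\<close>

lemma Ck_on_cong:
  assumes "open S" "\<And>q. q \<in> S \<Longrightarrow> f q = g q"
  shows "Ck_on k S f \<longleftrightarrow> Ck_on k S g"
  using assms(2)
proof (induction k arbitrary: f g)
  case 0
  then show ?case by (simp cong: continuous_on_cong)
next
  case (Suc k)
  have "Ck_on k S (\<lambda>p. frechet_derivative f (at p) h) \<longleftrightarrow> Ck_on k S (\<lambda>p. frechet_derivative g (at p) h)" for h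
    by (rule Suc.IH) (simp add: frechet_derivative_cong_open[OF assms(1) _ Suc.prems])
  then show ?case
    using differentiable_cong_open[OF assms(1) _ Suc.prems] by auto
qed

section \<open>Calculus rules for the two partial derivatives\<close>

lemma pd_t_eq_frechet_derivative:
  assumes "f differentiable (at p)"
  shows "pd_t f p = frechet_derivative f (at p) (1, 0)"
proof -
  have 1: "(f has_derivative frechet_derivative f (at p)) (at (fst p, snd p))"
    using assms by (simp add: frechet_derivative_works)
  have "((\<lambda>s. (s, snd p)) has_derivative (\<lambda>h. (h, 0))) (at (fst p))"
    by (auto intro!: derivative_eq_intros)
  from has_derivative_compose[OF this 1]
  have "((\<lambda>s. f (s, snd p)) has_derivative (\<lambda>h. frechet_derivative f (at p) (h *\<^sub>R (1, 0)))) (at (fst p))"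
    by simp
  then show ?thesis
    unfolding pd_t_def using has_derivative_linear[OF 1]
    by (intro vector_derivative_at) (simp only: has_vector_derivative_def linear_cmul)
qed

lemma pd_x_eq_frechet_derivative:
  assumes "f differentiable (at p)"
  shows "pd_x f p = frechet_derivative f (at p) (0, 1)"
proof -
  have 1: "(f has_derivative frechet_derivative f (at p)) (at (fst p, snd p))"
    using assms by (simp add: frechet_derivative_works)
  have "((\<lambda>s. (fst p, s)) has_derivative (\<lambda>h. (0, h))) (at (snd p))"
    by (auto intro!: derivative_eq_intros)
  from has_derivative_compose[OF this 1]
  have "((\<lambda>s. f (fst p, s)) has_derivative (\<lambda>h. frechet_derivative f (at p) (h *\<^sub>R (0, 1)))) (at (snd p))"
    by simp
  then show ?thesis
    unfolding pd_x_def using has_derivative_linear[OF 1]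
    by (intro vector_derivative_at) (simp only: has_vector_derivative_def linear_cmul)
qed

lemma pd_has_derivative:
  assumes "(f has_derivative f') (at p)"
  shows "pd_t f p = f' (1, 0)" "pd_x f p = f' (0, 1)"
proof -
  have "f differentiable (at p)" using assms by (auto simp: differentiable_def)
  then show "pd_t f p = f' (1, 0)" "pd_x f p = f' (0, 1)"
    by (simp_all add: pd_t_eq_frechet_derivative pd_x_eq_frechet_derivative
        flip: frechet_derivative_at[OF assms])
qed

text \<open>One linear map carries both partials, so each rule below is the Frechet rule evaluated
  at \<open>(1, 0)\<close> and \<open>(0, 1)\<close>.\<close>

lemma has_derivative_pd:
  assumes "f differentiable (at p)"
  obtains f' where "(f has_derivative f') (at p)" "f' (1, 0) = pd_t f p" "f' (0, 1) = pd_x f p"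
proof -
  obtain f' where f': "(f has_derivative f') (at p)"
    using assms by (auto simp: differentiable_def)
  show thesis
    by (rule that[OF f']) (simp_all add: pd_has_derivative[OF f'])
qed

lemma pd_const [simp]: "pd_t (\<lambda>q. c) p = 0" "pd_x (\<lambda>q. c) p = 0"
  by (simp_all add: pd_t_def pd_x_def)

lemma pd_add:
  assumes "f differentiable (at p)" "g differentiable (at p)"
  shows "pd_t (\<lambda>q. f q + g q) p = pd_t f p + pd_t g p" (is ?T)
    "pd_x (\<lambda>q. f q + g q) p = pd_x f p + pd_x g p" (is ?X)
proof -
  obtain f' where f: "(f has_derivative f') (at p)" "f' (1, 0) = pd_t f p" "f' (0, 1) = pd_x f p"
    using assms(1) by (rule has_derivative_pd)
  obtain g' where g: "(g has_derivative g') (at p)" "g' (1, 0) = pd_t g p" "g' (0, 1) = pd_x g p"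
    using assms(2) by (rule has_derivative_pd)
  note pd_has_derivative[OF has_derivative_add[OF f(1) g(1)]]
  then show ?T ?X by (simp_all add: f g)
qed

lemma pd_minus:
  assumes "f differentiable (at p)"
  shows "pd_t (\<lambda>q. - f q) p = - pd_t f p" (is ?T)
    "pd_x (\<lambda>q. - f q) p = - pd_x f p" (is ?X)
proof -
  obtain f' where f: "(f has_derivative f') (at p)" "f' (1, 0) = pd_t f p" "f' (0, 1) = pd_x f p"
    using assms by (rule has_derivative_pd)
  note pd_has_derivative[OF has_derivative_minus[OF f(1)]]
  then show ?T ?X by (simp_all add: f)
qed

lemma pd_diff:
  assumes "f differentiable (at p)" "g differentiable (at p)"
  shows "pd_t (\<lambda>q. f q - g q) p = pd_t f p - pd_t g p" (is ?T)
    "pd_x (\<lambda>q. f q - g q) p = pd_x f p - pd_x g p" (is ?X)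
proof -
  obtain f' where f: "(f has_derivative f') (at p)" "f' (1, 0) = pd_t f p" "f' (0, 1) = pd_x f p"
    using assms(1) by (rule has_derivative_pd)
  obtain g' where g: "(g has_derivative g') (at p)" "g' (1, 0) = pd_t g p" "g' (0, 1) = pd_x g p"
    using assms(2) by (rule has_derivative_pd)
  note pd_has_derivative[OF has_derivative_diff[OF f(1) g(1)]]
  then show ?T ?X by (simp_all add: f g)
qed

lemma pd_mult:
  fixes f g :: "real \<times> real \<Rightarrow> 'a::real_normed_algebra"
  assumes "f differentiable (at p)" "g differentiable (at p)"
  shows "pd_t (\<lambda>q. f q * g q) p = f p * pd_t g p + pd_t f p * g p" (is ?T)
    "pd_x (\<lambda>q. f q * g q) p = f p * pd_x g p + pd_x f p * g p" (is ?X)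
proof -
  obtain f' where f: "(f has_derivative f') (at p)" "f' (1, 0) = pd_t f p" "f' (0, 1) = pd_x f p"
    using assms(1) by (rule has_derivative_pd)
  obtain g' where g: "(g has_derivative g') (at p)" "g' (1, 0) = pd_t g p" "g' (0, 1) = pd_x g p"
    using assms(2) by (rule has_derivative_pd)
  note pd_has_derivative[OF has_derivative_mult[OF f(1) g(1)]]
  then show ?T ?X by (simp_all add: f g)
qed

lemma pd_divide:
  fixes f g :: "real \<times> real \<Rightarrow> 'a::real_normed_field"
  assumes "f differentiable (at p)" "g differentiable (at p)" "g p \<noteq> 0"
  shows "pd_t (\<lambda>q. f q / g q) p = (pd_t f p * g p - f p * pd_t g p) / (g p * g p)" (is ?T)
    "pd_x (\<lambda>q. f q / g q) p = (pd_x f p * g p - f p * pd_x g p) / (g p * g p)" (is ?X)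
proof -
  obtain f' where f: "(f has_derivative f') (at p)" "f' (1, 0) = pd_t f p" "f' (0, 1) = pd_x f p"
    using assms(1) by (rule has_derivative_pd)
  obtain g' where g: "(g has_derivative g') (at p)" "g' (1, 0) = pd_t g p" "g' (0, 1) = pd_x g p"
    using assms(2) by (rule has_derivative_pd)
  note pd_has_derivative[OF has_derivative_divide'[OF f(1) g(1) assms(3)]]
  then show ?T ?X by (simp_all add: f g)
qed

text \<open>Allows a matrix entry that is known only on \<open>D\<close> to be differentiated
  through its defining formula.\<close>

lemma pd_cong_open:
  assumes "open S" "p \<in> S" "\<And>q. q \<in> S \<Longrightarrow> f q = g q" "g differentiable (at p)"
  shows "pd_t f p = pd_t g p" "pd_x f p = pd_x g p"
  using assms frechet_derivative_cong_open[OF assms(1-3)] differentiable_cong_open[OF assms(1-3)]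
  by (simp_all add: pd_t_eq_frechet_derivative pd_x_eq_frechet_derivative)

lemma pd_bounded_linear:
  assumes "bounded_linear h" "f differentiable (at p)"
  shows "pd_t (\<lambda>q. h (f q)) p = h (pd_t f p)" (is ?T)
    "pd_x (\<lambda>q. h (f q)) p = h (pd_x f p)" (is ?X)
proof -
  obtain f' where f: "(f has_derivative f') (at p)" "f' (1, 0) = pd_t f p" "f' (0, 1) = pd_x f p"
    using assms(2) by (rule has_derivative_pd)
  note pd_has_derivative[OF bounded_linear.has_derivative[OF assms(1) f(1)]]
  then show ?T ?X by (simp_all add: f)
qed

section \<open>Partial derivatives of smooth functions\<close>

context
  fixes D :: "(real \<times> real) set" and f :: "real \<times> real \<Rightarrow> 'b::real_normed_vector"
  assumes D: "open D" and f: "smooth_on D f"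
begin

lemma smooth_on_differentiable: "p \<in> D \<Longrightarrow> f differentiable (at p)"
  using f[unfolded smooth_on_def, rule_format, of 1] by simp

lemma smooth_on_frechet_derivative: "smooth_on D (\<lambda>p. frechet_derivative f (at p) h)"
  unfolding smooth_on_def
proof
  fix k
  show "Ck_on k D (\<lambda>p. frechet_derivative f (at p) h)"
    using f[unfolded smooth_on_def, rule_format, of "Suc k"] by (simp del: split_paired_All)
qed

lemma smooth_on_pd: "smooth_on D (pd_t f)" "smooth_on D (pd_x f)"
  using smooth_on_frechet_derivative
  unfolding smooth_on_def
  by (simp_all add: Ck_on_cong[OF D pd_t_eq_frechet_derivative] Ck_on_cong[OF D pd_x_eq_frechet_derivative]
     smooth_on_differentiable)

end

lemma pd_commute:
  assumes D: "open D" "p \<in> D" and f: "smooth_on D f"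
  shows "pd_t (pd_x f) p = pd_x (pd_t f) p"
proof -
  note d = smooth_on_differentiable[OF D(1) f]
  have d2: "(\<lambda>q. frechet_derivative f (at q) h) differentiable (at p)" for h
    by (rule smooth_on_differentiable[OF D(1) smooth_on_frechet_derivative[OF D(1) f] D(2)])
  have "pd_t (pd_x f) p = pd_t (\<lambda>q. frechet_derivative f (at q) (0, 1)) p"
    by (rule pd_cong_open[OF D]) (simp_all add: d d2 pd_x_eq_frechet_derivative)
  also have "\<dots> = pd_x (\<lambda>q. frechet_derivative f (at q) (1, 0)) p"
    by (simp add: d2 pd_t_eq_frechet_derivative pd_x_eq_frechet_derivative
        frechet_derivative_commute[OF D d d2 d2, of "(0,1)"])
  also have "\<dots> = pd_x (pd_t f) p"
    by (rule pd_cong_open(2)[OF D, symmetric]) (simp_all add: d d2 pd_t_eq_frechet_derivative)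
  finally show ?thesis .
qed

section \<open>Derivatives of vectors and matrices of size two\<close>

lemma norm_axis: "norm (axis i (x::'a::real_normed_vector) :: 'a^'n) = norm x"
proof -
  have "norm (axis i x $ j) = (if j = i then norm x else 0)" for j
    by (simp add: axis_def)
  then show ?thesis by (simp add: norm_vec_def L2_set_def if_distrib[of "\<lambda>x. x\<^sup>2"] cong: if_cong)
qed

lemma bounded_linear_axis: "bounded_linear (axis i :: 'a::real_normed_vector \<Rightarrow> 'a^'n)"
proof (rule bounded_linear_intro[of _ 1])
  show "norm (axis i x :: 'a^'n) \<le> norm x * 1" for x
    by (simp add: norm_axis)
qed (simp_all add: vec_eq_iff axis_def)

lemma differentiable_axis:
  assumes "f differentiable (at p)"
  shows "(\<lambda>q. axis i (f q) :: 'b::real_normed_vector^'n) differentiable (at p)"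
  using assms unfolding differentiable_def
  by (blast intro: bounded_linear.has_derivative[OF bounded_linear_axis])

text \<open>A sum of bounded linear images of the entries, so derivatives are taken entrywise; a
  matrix is a vector of vectors, and the argument is applied twice.\<close>

lemma vector_2_eq_axis: "(vector [a, b] :: 'a::real_normed_vector^2) = axis 1 a + axis 2 b"
  by (simp add: vec_eq_iff forall_2 axis_def)

lemma differentiable_vector_2:
  fixes f g :: "'a::real_normed_vector \<Rightarrow> 'b::real_normed_vector"
  assumes "f differentiable (at p)" "g differentiable (at p)"
  shows "(\<lambda>q. vector [f q, g q] :: 'b^2) differentiable (at p)"
  unfolding vector_2_eq_axis
  by (intro differentiable_add differentiable_axis assms)

lemma pd_vector_2:
  fixes f g :: "real \<times> real \<Rightarrow> 'b::real_normed_vector"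
  assumes "f differentiable (at p)" "g differentiable (at p)"
  shows "pd_t (\<lambda>q. vector [f q, g q] :: 'b^2) p = vector [pd_t f p, pd_t g p]"
    "pd_x (\<lambda>q. vector [f q, g q] :: 'b^2) p = vector [pd_x f p, pd_x g p]"
  unfolding vector_2_eq_axis
  by (simp_all add: pd_add pd_bounded_linear[OF bounded_linear_axis] differentiable_axis assms)

text \<open>An eigenvector is assumed smooth as a vector; this recovers the differentiability of its
  components.\<close>

lemma differentiable_vector_2D:
  fixes f g :: "'a::real_normed_vector \<Rightarrow> 'b::real_normed_vector"
  assumes "(\<lambda>q. vector [f q, g q] :: 'b^2) differentiable (at p)"
  shows "f differentiable (at p)" "g differentiable (at p)"
proof -
  obtain h' where h: "((\<lambda>q. vector [f q, g q] :: 'b^2) has_derivative h') (at p)"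
    using assms by (auto simp: differentiable_def)
  have "((\<lambda>q. (vector [f q, g q] :: 'b^2) $ i) has_derivative (\<lambda>x. h' x $ i)) (at p)" for i
    by (rule bounded_linear.has_derivative[OF bounded_linear_vec_nth h])
  from this[of 1] this[of 2] show "f differentiable (at p)" "g differentiable (at p)"
    by (auto simp: differentiable_def)
qed

lemma differentiable_mat2:
  fixes a b c d :: "'a::real_normed_vector \<Rightarrow> 'b::real_normed_vector"
  assumes "a differentiable (at p)" "b differentiable (at p)"
    "c differentiable (at p)" "d differentiable (at p)"
  shows "(\<lambda>q. mat2 (a q) (b q) (c q) (d q)) differentiable (at p)"
  unfolding mat2_def by (intro differentiable_vector_2 assms)

lemma pd_mat2:
  fixes a b c d :: "real \<times> real \<Rightarrow> 'b::real_normed_vector"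
  assumes "a differentiable (at p)" "b differentiable (at p)"
    "c differentiable (at p)" "d differentiable (at p)"
  shows "pd_t (\<lambda>q. mat2 (a q) (b q) (c q) (d q)) p = mat2 (pd_t a p) (pd_t b p) (pd_t c p) (pd_t d p)"
    "pd_x (\<lambda>q. mat2 (a q) (b q) (c q) (d q)) p = mat2 (pd_x a p) (pd_x b p) (pd_x c p) (pd_x d p)"
  unfolding mat2_def by (simp_all add: pd_vector_2 differentiable_vector_2 assms)

section \<open>Pointwise algebra, with derivatives as independent symbols\<close>

lemma mat2_zero_curvature_iff:
  fixes l1 :: "'a::comm_ring_1"
  shows "mat2 l1t lpt lmt l2t - mat2 b1x bpx bmx b2x + mat2 l1 lp lm l2 ** mat2 b1 bp bm b2
      - mat2 b1 bp bm b2 ** mat2 l1 lp lm l2 = 0 \<longleftrightarrow>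
    l1t - b1x + lp * bm - bp * lm = 0 \<and>
    lpt - bpx + lp * (b2 - b1) + bp * (l1 - l2) = 0 \<and>
    lmt - bmx + lm * (b1 - b2) + bm * (l2 - l1) = 0 \<and>
    l2t - b2x - (lp * bm - bp * lm) = 0"
  by (simp add: vec_eq_iff forall_2 mat2_def matrix_matrix_mult_def sum_2 algebra_simps)

lemma mat2_mult_vector:
  fixes a :: "'a::comm_ring_1"
  shows "mat2 a b c d *v vector [x, y] = vector [a * x + b * y, c * x + d * y]"
  by (simp add: vec_eq_iff forall_2 mat2_def matrix_vector_mult_def sum_2)

text \<open>With \<open>P\<close> for L_+ and \<open>b\<close> for b_+: after division by
  \<open>P\<close> and elimination of \<open>l2\<close>, the claim is the prescription of
  \<open>B1 + B2\<close>.\<close>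

lemma curvature_12:
  fixes P :: "'a::field"
  assumes P: "P \<noteq> 0" and b1: "b * l1 - B1 = b1"
    and L: "l1 + l2 = - w - Px / P" and B: "B1 + B2 = bx - b * w - 2 * b1 - Pt / P"
  shows "Pt - (b * Px + bx * P) + P * (B2 - B1) + b * P * (l1 - l2) = 0"
proof -
  have l2: "l2 = - w - Px / P - l1" using L by (simp add: algebra_simps eq_diff_eq)
  have B2: "B2 = bx - b * w - 2 * b1 - Pt / P - B1" using B by (simp add: algebra_simps eq_diff_eq)
  have B1: "B1 = b * l1 - b1" using b1 by (simp add: algebra_simps eq_diff_eq)
  show ?thesis unfolding l2 B2 B1 using P by (simp add: field_simps)
qed

text \<open>Here \<open>N\<close> stands for L_+ L_-. Multiplied by \<open>P\<close>, the left-hand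
  side equals the second PDE (left minus right) minus \<open>l1\<close> times the first. The single
  symbol \<open>l1xt\<close> serves both orders of differentiation; its contributions from L_- and
  B_- cancel.\<close>

lemma curvature_21:
  fixes P :: "'a::field"
  assumes P: "P \<noteq> 0" and b1: "b * l1 - B1 = b1"
    and L: "l1 + l2 = - w - Px / P" and B: "B1 + B2 = bx - b * w - 2 * b1 - Pt / P"
    and N: "N = q - w * l1 - l1 * l1 - l1x"
    and Nt: "Nt = qt - (w * l1t + wt * l1) - (l1 * l1t + l1t * l1) - l1xt"
    and Nx: "Nx = qx - (w * l1x + wx * l1) - (l1 * l1x + l1x * l1) - l1xx"
    and B1x: "B1x = b * l1x + bx * l1 - b1x"
    and B1xx: "B1xx = b * l1xx + bx * l1x + (bx * l1x + bxx * l1) - b1xx"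
    and pde1: "wt + (bxx - (b * wx + bx * w) - 2 * b1x) = 0"
    and pde2: "qt + b1xx - b * qx + w * b1x = 2 * q * bx"
  shows "(Nt * P - N * Pt) / (P * P)
     - (b * ((Nx * P - N * Px) / (P * P)) + bx * (N / P) + ((B1xx - l1xt) * P - (B1x - l1t) * Px) / (P * P))
     + N / P * (B1 - B2) + (b * (N / P) + (B1x - l1t) / P) * (l2 - l1) = 0"
proof -
  define i where "i = inverse P"
  have i: "P * i = 1" using P by (simp add: i_def)
  have l2: "l2 = - w - Px * i - l1" using L by (simp add: i_def divide_inverse algebra_simps eq_diff_eq)
  have B2: "B2 = bx - b * w - 2 * b1 - Pt * i - B1" using B by (simp add: i_def divide_inverse algebra_simps eq_diff_eq)
  have B1: "B1 = b * l1 - b1" using b1 by (simp add: algebra_simps eq_diff_eq)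
  have wt: "wt = - (bxx - (b * wx + bx * w) - 2 * b1x)" using pde1 by (simp only: eq_neg_iff_add_eq_0)
  have qt: "qt = 2 * q * bx - b1xx + b * qx - w * b1x" using pde2 by (simp add: algebra_simps eq_diff_eq)
  have div: "x / P = x * i" "x / (P * P) = x * i * i" for x
    by (simp_all add: i_def divide_inverse)
  \<comment> \<open>A polynomial identity once everything is substituted, with \<open>i\<close> a
    free variable; \<open>P * i = 1\<close> matters only for the return to quotients.\<close>
  have "Nt - N * Pt * i - (b * (Nx - N * Px * i) + bx * N + (B1xx - l1xt) - (B1x - l1t) * Px * i)
     + N * (B1 - B2) + (b * N + (B1x - l1t)) * (l2 - l1) = 0"
    unfolding Nt Nx B1x B1xx N B2 l2 B1 wt qt by algebra
  then have "i * (Nt - N * Pt * i - (b * (Nx - N * Px * i) + bx * N + (B1xx - l1xt) - (B1x - l1t) * Px * i)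
     + N * (B1 - B2) + (b * N + (B1x - l1t)) * (l2 - l1)) = 0"
    by simp
  then show ?thesis unfolding div using i by algebra
qed

text \<open>The factor after \<open>\<sigma>\<close> is F_xx, expanded by the product rule from F_x
  = L1 F + L_+ G. After substitution the coefficients of \<open>F\<close> and of \<open>G\<close>
  vanish separately.\<close>

lemma fokker_planck_algebra:
  fixes P :: "'a::field"
  assumes P: "P \<noteq> 0" and \<sigma>: "\<sigma> \<noteq> 0" and b1: "b * l1 - B1 = b1"
    and L: "l1 + l2 = - ((\<kappa> * b + v) / \<sigma>) - Px / P"
    and Lm: "lm = 1 / P * ((\<kappa> * b1 - \<alpha> - (\<kappa> * b + v) * l1) / \<sigma> - l1\<^sup>2 - l1x)"
    and Fx: "Fx = l1 * F + P * G" and Gx: "Gx = lm * F + l2 * G"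
    and Ft: "Ft = B1 * F + b * P * G"
  shows "\<kappa> * Ft + \<sigma> * (l1 * Fx + l1x * F + (P * Gx + Px * G)) + v * Fx + \<alpha> * F = 0"
proof -
  have l2: "l2 = - ((\<kappa> * b + v) / \<sigma>) - Px / P - l1" using L by (simp add: algebra_simps eq_diff_eq)
  have B1: "B1 = b * l1 - b1" using b1 by (simp add: algebra_simps eq_diff_eq)
  show ?thesis unfolding Ft Gx Fx Lm l2 B1 using P \<sigma> by (simp add: field_simps power2_eq_square)
qed

text \<open>The second form is \<open>s\<close> times the first: the terms
  \<open>\<kappa> * b * b1x\<close> cancel, and the derivatives of \<open>s\<close> come from the
  quotient rule.\<close>

lemma second_pde_algebra:
  fixes s :: "'a::field"
  assumes s: "s \<noteq> 0"
  shows "((\<kappa> * b1t - \<alpha>t) * s - (\<kappa> * b1 - \<alpha>) * st) / (s * s) + b1xx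
      - b * (((\<kappa> * b1x - \<alpha>x) * s - (\<kappa> * b1 - \<alpha>) * sx) / (s * s)) + (\<kappa> * b + v) / s * b1x
        = 2 * ((\<kappa> * b1 - \<alpha>) / s) * bx \<longleftrightarrow>
    \<kappa> * b1t + s * b1xx + v * b1x = (2 * bx + st / s - sx / s * b) * (\<kappa> * b1 - \<alpha>) + \<alpha>t - b * \<alpha>x"
    (is "?l = ?r \<longleftrightarrow> ?l' = ?r'")
proof -
  have "s * (?l - ?r) = ?l' - ?r'" using s by (simp add: field_simps)
  then show ?thesis using s by (metis eq_iff_diff_eq_0 mult_eq_0_iff)
qed

section \<open>The Lax pair and its eigenvectors\<close>

theorem theorem1:
  fixes D :: "(real \<times> real) set"
    and \<kappa> :: "'a::real_normed_field"
    and \<sigma> v \<alpha> bp b1 :: "real \<times> real \<Rightarrow> 'a"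
  assumes "open D"
    and "\<kappa> \<noteq> 0"
    and "smooth_on D \<sigma>" "smooth_on D v" "smooth_on D \<alpha>"
    and "\<forall>p\<in>D. \<sigma> p \<noteq> 0"
    and "smooth_on D bp" "smooth_on D b1"
    and "first_pde_on D \<kappa> \<sigma> v bp b1"
  shows "(second_pde_on D \<kappa> \<sigma> v \<alpha> bp b1 \<longleftrightarrow> second_pde_alt_on D \<kappa> \<sigma> v \<alpha> bp b1) \<and>
    (second_pde_on D \<kappa> \<sigma> v \<alpha> bp b1 \<longrightarrow>
      (\<forall>Lp L1 B1 L2 Lm Bp B2 Bm :: real \<times> real \<Rightarrow> 'a.
        smooth_on D Lp \<and> (\<forall>p\<in>D. Lp p \<noteq> 0) \<and>
        smooth_on D L1 \<and> smooth_on D B1 \<and>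
        (\<forall>p\<in>D. bp p * L1 p - B1 p = b1 p) \<and>
        (\<forall>p\<in>D. Bp p = bp p * Lp p) \<and>
        (\<forall>p\<in>D. L1 p + L2 p = - ((\<kappa> * bp p + v p) / \<sigma> p) - pd_x Lp p / Lp p) \<and>
        (\<forall>p\<in>D. B1 p + B2 p =
           pd_x bp p - bp p * (\<kappa> * bp p + v p) / \<sigma> p - 2 * b1 p - pd_t Lp p / Lp p) \<and>
        (\<forall>p\<in>D. Lm p =
           1 / Lp p * ((\<kappa> * b1 p - \<alpha> p - (\<kappa> * bp p + v p) * L1 p) / \<sigma> p
             - (L1 p)\<^sup>2 - pd_x L1 p)) \<and>
        (\<forall>p\<in>D. Bm p = bp p * Lm p + (pd_x B1 p - pd_t L1 p) / Lp p)
        \<longrightarrow>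
        (let L = (\<lambda>p. mat2 (L1 p) (Lp p) (Lm p) (L2 p));
             B = (\<lambda>p. mat2 (B1 p) (Bp p) (Bm p) (B2 p))
         in lax_pair_on D L B \<and>
            (\<forall>U F G. open U \<and> U \<subseteq> D \<and> lax_eigenvector_on U L B (\<lambda>p. vector [F p, G p]) \<longrightarrow>
              (\<forall>p\<in>U. \<kappa> * pd_t F p + \<sigma> p * pd_x (pd_x F) p + v p * pd_x F p + \<alpha> p * F p = 0)))))"
proof (intro conjI impI allI)
  note sm = smooth_on_differentiable[OF assms(1)]
  note sx = smooth_on_pd[OF assms(1)]
  note base = sm[OF assms(3)] sm[OF assms(4)] sm[OF assms(5)] sm[OF assms(7)] sm[OF assms(8)]
  note base' = sm[OF sx(2)[OF assms(7)]] sm[OF sx(2)[OF assms(8)]]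
  have \<sigma>: "\<sigma> p \<noteq> 0" if "p \<in> D" for p using assms(6) that by blast
  show "second_pde_on D \<kappa> \<sigma> v \<alpha> bp b1 \<longleftrightarrow> second_pde_alt_on D \<kappa> \<sigma> v \<alpha> bp b1"
    unfolding second_pde_on_def second_pde_alt_on_def
    by (intro ball_cong refl, subst second_pde_algebra[OF \<sigma>, symmetric])
      (simp_all add: base \<sigma> pd_divide pd_diff pd_mult)

  fix Lp L1 B1 L2 Lm Bp B2 Bm :: "real \<times> real \<Rightarrow> 'a"
  assume pde2: "second_pde_on D \<kappa> \<sigma> v \<alpha> bp b1"
    and H: "smooth_on D Lp \<and> (\<forall>p\<in>D. Lp p \<noteq> 0) \<and>
        smooth_on D L1 \<and> smooth_on D B1 \<and>
        (\<forall>p\<in>D. bp p * L1 p - B1 p = b1 p) \<and>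
        (\<forall>p\<in>D. Bp p = bp p * Lp p) \<and>
        (\<forall>p\<in>D. L1 p + L2 p = - ((\<kappa> * bp p + v p) / \<sigma> p) - pd_x Lp p / Lp p) \<and>
        (\<forall>p\<in>D. B1 p + B2 p =
           pd_x bp p - bp p * (\<kappa> * bp p + v p) / \<sigma> p - 2 * b1 p - pd_t Lp p / Lp p) \<and>
        (\<forall>p\<in>D. Lm p =
           1 / Lp p * ((\<kappa> * b1 p - \<alpha> p - (\<kappa> * bp p + v p) * L1 p) / \<sigma> p
             - (L1 p)\<^sup>2 - pd_x L1 p)) \<and>
        (\<forall>p\<in>D. Bm p = bp p * Lm p + (pd_x B1 p - pd_t L1 p) / Lp p)"
  then have sLp: "smooth_on D Lp" and Lp0: "\<And>p. p \<in> D \<Longrightarrow> Lp p \<noteq> 0"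
    and sL1: "smooth_on D L1" and sB1: "smooth_on D B1"
    and b1: "\<And>p. p \<in> D \<Longrightarrow> bp p * L1 p - B1 p = b1 p"
    and Bp: "\<And>p. p \<in> D \<Longrightarrow> Bp p = bp p * Lp p"
    and L2: "\<And>p. p \<in> D \<Longrightarrow> L1 p + L2 p = - ((\<kappa> * bp p + v p) / \<sigma> p) - pd_x Lp p / Lp p"
    and B2: "\<And>p. p \<in> D \<Longrightarrow> B1 p + B2 p =
           pd_x bp p - bp p * (\<kappa> * bp p + v p) / \<sigma> p - 2 * b1 p - pd_t Lp p / Lp p"
    and Lm: "\<And>p. p \<in> D \<Longrightarrow> Lm p =
           1 / Lp p * ((\<kappa> * b1 p - \<alpha> p - (\<kappa> * bp p + v p) * L1 p) / \<sigma> p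
             - (L1 p)\<^sup>2 - pd_x L1 p)"
    and Bm: "\<And>p. p \<in> D \<Longrightarrow> Bm p = bp p * Lm p + (pd_x B1 p - pd_t L1 p) / Lp p"
    by blast+
  note d = base base' sm[OF sLp] sm[OF sL1] sm[OF sB1] sm[OF sx(1)[OF sLp]] sm[OF sx(2)[OF sLp]]
    sm[OF sx(1)[OF sL1]] sm[OF sx(2)[OF sL1]] sm[OF sx(2)[OF sB1]]

  \<comment> \<open>\<open>w\<close> and \<open>q\<close> are the coefficients of F_xx = - w F_x + q
    F. On \<open>D\<close>, \<open>N\<close> is L_+ L_- and \<open>M\<close> is L_+ (B_- - b_+ L_-),
    so that dividing by L_+ is the last operation in both entries.\<close>
  define w where "w p = (\<kappa> * bp p + v p) / \<sigma> p" for p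
  define q where "q p = (\<kappa> * b1 p - \<alpha> p) / \<sigma> p" for p
  define N where "N p = q p - w p * L1 p - L1 p * L1 p - pd_x L1 p" for p
  define M where "M p = pd_x B1 p - pd_t L1 p" for p
  have dw: "w differentiable (at p)" and dq: "q differentiable (at p)" if "p \<in> D" for p
    using that \<sigma>[OF that] unfolding w_def q_def by (intro derivative_intros d; simp)+
  have dN: "N differentiable (at p)" and dM: "M differentiable (at p)" if "p \<in> D" for p
    using that unfolding N_def M_def by (intro derivative_intros d dw dq; simp)+

  have LmN: "Lm p = N p / Lp p" if "p \<in> D" for p
    using \<sigma>[OF that] by (simp add: Lm[OF that] N_def q_def w_def power2_eq_square diff_divide_distrib)
  have BmN: "Bm p = bp p * (N p / Lp p) + M p / Lp p" if "p \<in> D" for p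
    by (simp add: Bm[OF that] LmN[OF that] M_def)
  have L2': "L2 p = - w p - pd_x Lp p / Lp p - L1 p" if "p \<in> D" for p
    using L2[OF that] by (simp add: w_def algebra_simps eq_diff_eq)
  have B2': "B2 p = pd_x bp p - bp p * w p - 2 * b1 p - pd_t Lp p / Lp p - B1 p" if "p \<in> D" for p
    using B2[OF that] by (simp add: w_def algebra_simps eq_diff_eq)

  note eqs = Bp LmN BmN L2' B2'
  \<comment> \<open>The regularity of the five dependent entries is read off from their formulas and
    then transferred along the equalities on \<open>D\<close>.\<close>
  have dE: "(\<lambda>p. bp p * Lp p) differentiable (at p)" "(\<lambda>p. N p / Lp p) differentiable (at p)"
    "(\<lambda>p. bp p * (N p / Lp p) + M p / Lp p) differentiable (at p)"
    "(\<lambda>p. - w p - pd_x Lp p / Lp p - L1 p) differentiable (at p)"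
    "(\<lambda>p. pd_x bp p - bp p * w p - 2 * b1 p - pd_t Lp p / Lp p - B1 p) differentiable (at p)"
    if "p \<in> D" for p
    using that Lp0[OF that] by (intro derivative_intros d dw dN dM; simp)+
  have dBp: "Bp differentiable (at p)" and dLm: "Lm differentiable (at p)"
    and dBm: "Bm differentiable (at p)" and dL2: "L2 differentiable (at p)"
    and dB2: "B2 differentiable (at p)" if "p \<in> D" for p
    using that differentiable_cong_open[OF assms(1) that eqs(1)]
      differentiable_cong_open[OF assms(1) that eqs(2)]
      differentiable_cong_open[OF assms(1) that eqs(3)]
      differentiable_cong_open[OF assms(1) that eqs(4)]
      differentiable_cong_open[OF assms(1) that eqs(5)] dE[OF that]
    by simp_all

  have curv: "pd_t (\<lambda>p. mat2 (L1 p) (Lp p) (Lm p) (L2 p)) p - pd_x (\<lambda>p. mat2 (B1 p) (Bp p) (Bm p) (B2 p)) p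
     + mat2 (L1 p) (Lp p) (Lm p) (L2 p) ** mat2 (B1 p) (Bp p) (Bm p) (B2 p)
     - mat2 (B1 p) (Bp p) (Bm p) (B2 p) ** mat2 (L1 p) (Lp p) (Lm p) (L2 p) = 0" if p: "p \<in> D" for p
  proof -
    note dp = d[OF p] dw[OF p] dq[OF p] dN[OF p] dM[OF p]
    note cong = pd_cong_open[OF assms(1) p eqs(1) dE(1)[OF p]] pd_cong_open[OF assms(1) p eqs(2) dE(2)[OF p]]
      pd_cong_open[OF assms(1) p eqs(3) dE(3)[OF p]] pd_cong_open[OF assms(1) p eqs(4) dE(4)[OF p]]
      pd_cong_open[OF assms(1) p eqs(5) dE(5)[OF p]]
    have comm: "pd_t (pd_x L1) p = pd_x (pd_t L1) p" "pd_t (pd_x Lp) p = pd_x (pd_t Lp) p"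
      by (rule pd_commute[OF assms(1) p sL1] pd_commute[OF assms(1) p sLp])+
    have B1eq: "B1 r = bp r * L1 r - b1 r" if "r \<in> D" for r
      using b1[OF that] by (simp add: algebra_simps eq_diff_eq)
    \<comment> \<open>Proved on all of \<open>D\<close>, not only at \<open>p\<close>, because it is
      differentiated once more to give \<open>B1xx\<close>.\<close>
    have B1x: "pd_x B1 r = bp r * pd_x L1 r + pd_x bp r * L1 r - pd_x b1 r" if "r \<in> D" for r
      using pd_cong_open(2)[OF assms(1) that B1eq] d[OF that] by (simp add: pd_diff pd_mult)
    have B1xx: "pd_x (pd_x B1) p = bp p * pd_x (pd_x L1) p + pd_x bp p * pd_x L1 p
       + (pd_x bp p * pd_x L1 p + pd_x (pd_x bp) p * L1 p) - pd_x (pd_x b1) p"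
      using pd_cong_open(2)[OF assms(1) p B1x] d[OF p] by (simp add: pd_diff pd_mult pd_add)
    have "(\<lambda>r. (\<kappa> * bp r + v r) / \<sigma> r) = w" "(\<lambda>r. (\<kappa> * b1 r - \<alpha> r) / \<sigma> r) = q"
      by (simp_all add: fun_eq_iff w_def q_def)
    then have e1: "pd_t w p + (pd_x (pd_x bp) p - (bp p * pd_x w p + pd_x bp p * w p) - 2 * pd_x b1 p) = 0"
      and e2: "pd_t q p + pd_x (pd_x b1) p - bp p * pd_x q p + w p * pd_x b1 p = 2 * q p * pd_x bp p"
      using bspec[OF assms(9)[unfolded first_pde_on_def] p] bspec[OF pde2[unfolded second_pde_on_def] p] dp
      by (simp_all add: pd_diff pd_mult flip: w_def q_def times_divide_eq_right)
    have Nt: "pd_t N p = pd_t q p - (w p * pd_t L1 p + pd_t w p * L1 p)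
        - (L1 p * pd_t L1 p + pd_t L1 p * L1 p) - pd_x (pd_t L1) p"
      unfolding N_def using dp by (simp add: pd_diff pd_mult comm)
    have Nx: "pd_x N p = pd_x q p - (w p * pd_x L1 p + pd_x w p * L1 p)
        - (L1 p * pd_x L1 p + pd_x L1 p * L1 p) - pd_x (pd_x L1) p"
      unfolding N_def using dp by (simp add: pd_diff pd_mult)
    have Mx: "pd_x M p = pd_x (pd_x B1) p - pd_x (pd_t L1) p"
      unfolding M_def using dp by (simp add: pd_diff)
    note L2p = L2[OF p, folded w_def]
    have B2p: "B1 p + B2 p = pd_x bp p - bp p * w p - 2 * b1 p - pd_t Lp p / Lp p"
      using B2[OF p] by (simp add: w_def)
    have 1: "pd_t L1 p - pd_x B1 p + Lp p * Bm p - Bp p * Lm p = 0"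
      using Lp0[OF p] by (simp add: eqs p M_def field_simps)
    have 2: "pd_t Lp p - pd_x Bp p + Lp p * (B2 p - B1 p) + Bp p * (L1 p - L2 p) = 0"
      using curvature_12[OF Lp0[OF p] b1[OF p] L2p B2p] dp
      by (simp add: cong pd_mult Bp p)
    have 3: "pd_t Lm p - pd_x Bm p + Lm p * (B1 p - B2 p) + Bm p * (L2 p - L1 p) = 0"
      using curvature_21[OF Lp0[OF p] b1[OF p] L2p B2p N_def Nt Nx B1x[OF p] B1xx e1 e2] dp Lp0[OF p]
      by (simp add: cong pd_mult pd_add pd_divide Mx LmN BmN p del: times_divide_eq_right flip: M_def)
    \<comment> \<open>In the trace \<open>L1\<close> and \<open>B1\<close> cancel. The quotient rule
      and the equal mixed partials of \<open>Lp\<close> make the t-derivative of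
      \<open>pd_x Lp / Lp\<close> equal to the x-derivative of \<open>pd_t Lp / Lp\<close>; what is
      left is minus the first PDE.\<close>
    have "pd_t L1 p + pd_t L2 p - (pd_x B1 p + pd_x B2 p) = 0"
      using dp Lp0[OF p] e1
      by (simp add: cong pd_diff pd_minus pd_mult pd_divide comm) algebra
    \<comment> \<open>A commutator has trace zero, so subtracting the (1,1) entry from the trace
      leaves the (2,2) entry.\<close>
    with 1 have 4: "pd_t L2 p - pd_x B2 p - (Lp p * Bm p - Bp p * Lm p) = 0"
      by algebra
    show ?thesis
      unfolding pd_mat2(1)[OF sm[OF sL1 p] sm[OF sLp p] dLm[OF p] dL2[OF p]]
        pd_mat2(2)[OF sm[OF sB1 p] dBp[OF p] dBm[OF p] dB2[OF p]] mat2_zero_curvature_iff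
      by (intro conjI 1 2 3 4)
  qed

  have fp: "\<kappa> * pd_t F p + \<sigma> p * pd_x (pd_x F) p + v p * pd_x F p + \<alpha> p * F p = 0"
    if U: "open U" "U \<subseteq> D" "p \<in> U"
      and ev: "lax_eigenvector_on U (\<lambda>p. mat2 (L1 p) (Lp p) (Lm p) (L2 p))
         (\<lambda>p. mat2 (B1 p) (Bp p) (Bm p) (B2 p)) (\<lambda>p. vector [F p, G p])" for U F G p
  proof -
    have dFG: "F differentiable (at r)" "G differentiable (at r)" if "r \<in> U" for r
      using ev smooth_on_differentiable[OF U(1) _ that] differentiable_vector_2D[of F G r]
      unfolding lax_eigenvector_on_def by blast+
    \<comment> \<open>The equation for F_x is needed throughout the open set \<open>U\<close>, since
      F_xx is obtained by differentiating it.\<close>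
    have Fx: "pd_x F r = L1 r * F r + Lp r * G r" and Gx: "pd_x G r = Lm r * F r + L2 r * G r"
      and Ft: "pd_t F r = B1 r * F r + Bp r * G r" if "r \<in> U" for r
      using ev that dFG[OF that]
      by (auto simp: lax_eigenvector_on_def mat2_mult_vector pd_vector_2 vec_eq_iff forall_2)
    have p: "p \<in> D" using U by blast
    have "pd_x (pd_x F) p = L1 p * pd_x F p + pd_x L1 p * F p + (Lp p * pd_x G p + pd_x Lp p * G p)"
      using pd_cong_open(2)[OF U(1,3) Fx] dFG[OF U(3)] d[OF p] by (simp add: pd_add pd_mult)
    then show ?thesis
      using fokker_planck_algebra[OF Lp0[OF p] \<sigma>[OF p] b1[OF p] L2[OF p] Lm[OF p] Fx[OF U(3)] Gx[OF U(3)]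
        Ft[OF U(3), unfolded Bp[OF p]]]
      by simp
  qed

  have "(\<lambda>p. mat2 (L1 p) (Lp p) (Lm p) (L2 p)) differentiable (at p)"
    "(\<lambda>p. mat2 (B1 p) (Bp p) (Bm p) (B2 p)) differentiable (at p)" if "p \<in> D" for p
    using that by (intro differentiable_mat2 d dL2 dLm dB2 dBm dBp; simp)+
  then have "lax_pair_on D (\<lambda>p. mat2 (L1 p) (Lp p) (Lm p) (L2 p)) (\<lambda>p. mat2 (B1 p) (Bp p) (Bm p) (B2 p))"
    using curv unfolding lax_pair_on_def differentiable_on_def
    by (auto intro: differentiable_at_withinI)
  then show "let L = (\<lambda>p. mat2 (L1 p) (Lp p) (Lm p) (L2 p));
             B = (\<lambda>p. mat2 (B1 p) (Bp p) (Bm p) (B2 p))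
         in lax_pair_on D L B \<and>
            (\<forall>U F G. open U \<and> U \<subseteq> D \<and> lax_eigenvector_on U L B (\<lambda>p. vector [F p, G p]) \<longrightarrow>
              (\<forall>p\<in>U. \<kappa> * pd_t F p + \<sigma> p * pd_x (pd_x F) p + v p * pd_x F p + \<alpha> p * F p = 0))"
    using fp unfolding Let_def by blast
qed

end
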